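(* Let $V$ be a vertex superalgebra of countable dimension over $\mathbb{C}$, $G$ a finite subgroup of $\mathrm{Aut}(V)$, and $h\in Z(G)$ an element of the center of $G$. Let $M$ be an irreducible weak $h$-twisted $V$-module such that $M\cong g\circ M$ for all $g\in G$. Let $\hat G$ be the finite central extension of $G$ acting on $M$ described in the context, and let $\lambda$ be a linear character of $\hat G$, i.e. an irreducible character with $\lambda(1)=1$. Let $M^\lambda=P_\lambda(M)$ be the $\lambda$-isotypic component of $M$. If $M^\lambda\neq 0$, then $M^\lambda$ is irreducible as a $V^G$-module.
   Context: All spaces are over $\mathbb{C}$. A vertex superalgebra $(V,\mathbf 1,D,Y)$, $V=V_{\bar 0}\oplus V_{\bar 1}$, is defined by the usual axioms (truncation, $D$-derivative property, vacuum, creation, and the super Jacobi identity with sign $(-1)^{|u||v|}$). An automorphism of $V$ is a linear automorphism $g$ of $V$ with $gY(v,z)g^{-1}=Y(gv,z)$ for all $v\in V$; $V^G=\{v\in V: gv=v\ \forall g\in G\}$. Weak twisted modules: let $g\in\mathrm{Aut}(V)$ have finite order $T$, and fix a primitive $T$-th root of unity $\eta$. A weak $g$-twisted $V$-module is a vector space $M$ (not required to be $\mathbb{Z}_2$-graded) with a linear map $v\mapsto Y_g(v,z)=\sum_{n\in\frac1T\mathbb{Z}}v_nz^{-n-1}\in(\mathrm{End}\,M)[[z^{1/T},z^{-1/T}]]$ such that: $v_nw=0$ for $n$ sufficiently large (for each $v\in V$, $w\in M$); $Y_g(\mathbf 1,z)=\mathrm{Id}_M$; and for parity-homogeneous $u,v\in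 V$, $$z_0^{-1}\delta\Big(\tfrac{z_1-z_2}{z_0}\Big)Y_g(u,z_1)Y_g(v,z_2)-(-1)^{|u||v|}z_0^{-1}\delta\Big(\tfrac{z_2-z_1}{-z_0}\Big)Y_g(v,z_2)Y_g(u,z_1)=\frac{z_2^{-1}}{T}\sum_{j\in\mathbb{Z}/T\mathbb{Z}}\delta\Big(\eta^j\tfrac{(z_1-z_0)^{1/T}}{z_2^{1/T}}\Big)Y_g(Y(g^ju,z_0)v,z_2).$$ Irreducible means nonzero with no nonzero proper subspace stable under all modes $v_n$ (with $v\in V$, respectively $v\in V^G$ for $V^G$-modules); an isomorphism is a linear bijection intertwining all operators $v_n$. For $g\in G$, $g\circ M$ is $M$ as a vector space with $Y_{g\circ M}(v,z)=Y_M(g^{-1}v,z)$. The group $\hat G$: since $g\circ M\cong M$ for all $g\in G$, Schur's lemma gives linear automorphisms $\phi(g)$ of $M$ ($g\in G$), each unique up to a scalar, with $\phi(g)^{-1}Y_M(v,z)\phi(g)=Y_M(g^{-1}v,z)$ for all $v\in V$, and $\phi(g)\phi(k)=\alpha_M(g,k)\phi(gk)$ for a 2-cocycle $\alpha_M$ of $G$ with values in $\mathbb{C}^*$. The $\phi(g)$ are normalized so that all values of $\alpha_M$ are roots of unity; let $n$ be the smallest positive integer with $\alpha_M(g,k)^n=1$ for all $g,k$, and let $\xi_n$ be a primitive $n$-th root of unity. Then $1\to\langle\xi_n\rangle\to\hat G\to G\to1$ is the central extension associated with $\alpha_M$: $\hat G=\langle\xi_n\rangle\times G$ as a set, with $(\xi,g)(\xi',k)=(\xi\xi'\alpha_M(g,k),gk)$,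 acting on $M$ by $(\xi,g)\mapsto \xi\phi(g)$. For an irreducible character $\lambda$ of $\hat G$, $P_\lambda=\frac{\lambda(1)}{|\hat G|}\sum_{x\in\hat G}\lambda(x^{-1})x$, so that $M=\bigoplus_{\lambda\in\mathrm{Irr}(\hat G)}M^\lambda$ with $M^\lambda=P_\lambda(M)$. *)

theory Defs
  imports
    Complex_Main
    "HOL-Library.Groups_Big_Fun"
    "HOL-Library.Product_Plus"
    "HOL-Library.Countable_Set"
    "HOL-Library.Z2"
    "HOL-Algebra.Multiplicative_Group"
    "Jordan_Normal_Form.Matrix"
begin

section \<open>Formal series and delta functions\<close>

text \<open>
  A formal series in three variables, with rational exponents, is its coefficient function:
  \<open>X (a, b, c)\<close> is the coefficient of \<open>z0^a z1^b z2^c\<close>.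
\<close>

type_synonym 'a series3 = "rat \<times> rat \<times> rat \<Rightarrow> 'a"

definition monomial3 :: "rat \<times> rat \<times> rat \<Rightarrow> complex series3"
  where "monomial3 e = (\<lambda>e'. if e' = e then 1 else 0)"

text \<open>
  \<^const>\<open>Sum_any\<close> is the sum of a finitely supported family. All three products occurring in the
  Jacobi identity below have finitely many nonzero contributions to each coefficient, by truncation.
\<close>

definition series_mult ::
    "(complex \<Rightarrow> 'm \<Rightarrow> 'm) \<Rightarrow> complex series3 \<Rightarrow> 'm series3 \<Rightarrow> 'm::ab_group_add series3"
  where "series_mult s d X = (\<lambda>e. Sum_any (\<lambda>e'. s (d e') (X (e - e'))))"

text \<open>
  With \<open>\<delta>(x) = \<Sum>n. x^n\<close> (\<open>n\<close> an integer), powers of a binomial are expanded in nonnegative powers of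
  its second summand:

  \<^item> \<open>z0^-1 \<delta>((z1 - z2)/z0) = \<Sum>n. \<Sum>k. (-1)^k (n choose k) z0^(-n-1) z1^(n-k) z2^k\<close>

  \<^item> \<open>z0^-1 \<delta>((z2 - z1)/(-z0)) = \<Sum>n. \<Sum>k. (-1)^n (-1)^k (n choose k) z0^(-n-1) z1^k z2^(n-k)\<close>

  \<^item> \<open>z2^-1 \<delta>(\<eta>^j (z1 - z0)^(1/T) / z2^(1/T))
      = \<Sum>n. \<Sum>k. \<eta>^(j n) (-1)^k (n/T choose k) z0^k z1^(n/T-k) z2^(-n/T-1)\<close>
\<close>

definition delta12 :: "complex series3"
  where "delta12 e = Sum_any (\<lambda>(n::int, k::nat).
    (-1) ^ k * (of_int n gchoose k) * monomial3 (- of_int n - 1, of_int n - of_nat k, of_nat k) e)"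

definition delta21 :: "complex series3"
  where "delta21 e = Sum_any (\<lambda>(n::int, k::nat).
    (-1) powi n * (-1) ^ k * (of_int n gchoose k)
      * monomial3 (- of_int n - 1, of_nat k, of_int n - of_nat k) e)"

definition delta10 :: "nat \<Rightarrow> complex \<Rightarrow> nat \<Rightarrow> complex series3"
  where "delta10 T \<eta> j e = Sum_any (\<lambda>(n::int, k::nat).
    \<eta> powi (int j * n) * (-1) ^ k * ((of_int n / of_nat T) gchoose k)
      * monomial3 (of_nat k, of_int n / of_nat T - of_nat k, - (of_int n / of_nat T) - 1) e)"


section \<open>The (twisted) super Jacobi identity\<close>

text \<open>
  The field \<open>Y(v,z) = \<Sum>n. v_n z^(-n-1)\<close> is given by its modes: \<open>Y v n\<close> is the operator \<open>v_n\<close>, where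
  \<open>n\<close> is an integer for a vertex superalgebra and a rational number for a twisted module.
\<close>

definition int_modes :: "('v \<Rightarrow> int \<Rightarrow> 'm \<Rightarrow> 'm) \<Rightarrow> 'v \<Rightarrow> rat \<Rightarrow> 'm \<Rightarrow> 'm::ab_group_add"
  where "int_modes Y v n = (if n \<in> \<int> then Y v \<lfloor>n\<rfloor> else (\<lambda>_. 0))"

text \<open>The series \<open>Y(u,z1) Y(v,z2) w\<close>, \<open>Y(v,z2) Y(u,z1) w\<close> and \<open>Y_M(Y(u,z0) v, z2) w\<close>.\<close>

definition prod12 :: "('v \<Rightarrow> rat \<Rightarrow> 'm \<Rightarrow> 'm) \<Rightarrow> 'v \<Rightarrow> 'v \<Rightarrow> 'm \<Rightarrow> 'm::ab_group_add series3"
  where "prod12 YM u v w = (\<lambda>(a, b, c). if a = 0 then YM u (- b - 1) (YM v (- c - 1) w) else 0)"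

definition prod21 :: "('v \<Rightarrow> rat \<Rightarrow> 'm \<Rightarrow> 'm) \<Rightarrow> 'v \<Rightarrow> 'v \<Rightarrow> 'm \<Rightarrow> 'm::ab_group_add series3"
  where "prod21 YM u v w = (\<lambda>(a, b, c). if a = 0 then YM v (- c - 1) (YM u (- b - 1) w) else 0)"

definition iterate20 ::
    "('v \<Rightarrow> int \<Rightarrow> 'v \<Rightarrow> 'v) \<Rightarrow> ('v \<Rightarrow> rat \<Rightarrow> 'm \<Rightarrow> 'm) \<Rightarrow> 'v \<Rightarrow> 'v \<Rightarrow> 'm \<Rightarrow> 'm::ab_group_add series3"
  where "iterate20 Y YM u v w =
    (\<lambda>(a, b, c). if b = 0 \<and> a \<in> \<int> then YM (Y u \<lfloor>- a - 1\<rfloor> v) (- c - 1) w else 0)"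

text \<open>
  The identity for \<open>u\<close> of parity \<open>p\<close> and \<open>v\<close> of parity \<open>q\<close>, applied to a vector \<open>w\<close>. For \<open>T = 1\<close>,
  \<open>\<eta> = 1\<close> and \<open>g = id\<close> it is the ordinary super Jacobi identity.
\<close>

definition jacobi ::
    "nat \<Rightarrow> complex \<Rightarrow> ('v \<Rightarrow> 'v) \<Rightarrow> ('v \<Rightarrow> int \<Rightarrow> 'v \<Rightarrow> 'v) \<Rightarrow> (complex \<Rightarrow> 'm \<Rightarrow> 'm) \<Rightarrow>
     ('v \<Rightarrow> rat \<Rightarrow> 'm \<Rightarrow> 'm) \<Rightarrow> bit \<Rightarrow> bit \<Rightarrow> 'v \<Rightarrow> 'v \<Rightarrow> 'm::ab_group_add \<Rightarrow> bool"
  where "jacobi T \<eta> g Y sM YM p q u v w \<longleftrightarrow>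
    (\<forall>e. series_mult sM delta12 (prod12 YM u v w) e
        - sM (if p = 1 \<and> q = 1 then -1 else 1) (series_mult sM delta21 (prod21 YM u v w) e)
      = sM (1 / of_nat T)
          (\<Sum>j<T. series_mult sM (delta10 T \<eta> j) (iterate20 Y YM ((g ^^ j) u) v w) e))"


section \<open>Vertex superalgebras and their automorphisms\<close>

text \<open>
  Complex vector spaces are types with an explicit scalar multiplication; \<open>P 0\<close> and \<open>P 1\<close> are the
  even and the odd part of \<open>V\<close>.
\<close>

locale vertex_superalgebra = vector_space sV
  for sV :: "complex \<Rightarrow> 'v::ab_group_add \<Rightarrow> 'v" +
  fixes P :: "bit \<Rightarrow> 'v set"
    and vac :: 'v
    and D :: "'v \<Rightarrow> 'v"
    and Y :: "'v \<Rightarrow> int \<Rightarrow> 'v \<Rightarrow> 'v"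
  assumes subspace_parity: "subspace (P p)"
    and parity_direct_sum: "\<exists>!(a, b). a \<in> P 0 \<and> b \<in> P 1 \<and> v = a + b"
    and vac_even: "vac \<in> P 0"
    and parity_modes: "u \<in> P p \<Longrightarrow> v \<in> P q \<Longrightarrow> Y u n v \<in> P (p + q)"
    and linear_D: "Vector_Spaces.linear sV sV D"
    and linear_field: "Vector_Spaces.linear sV sV (\<lambda>v. Y v n x)"
    and linear_mode: "Vector_Spaces.linear sV sV (Y v n)"
    and truncation: "\<exists>N. \<forall>n\<ge>N. Y u n v = 0"
    and D_derivative: "Y (D v) n x = sV (- of_int n) (Y v (n - 1) x)"
    and vacuum: "Y vac n x = (if n = -1 then x else 0)"
    and creation: "n \<ge> 0 \<Longrightarrow> Y v n vac = 0" "Y v (-1) vac = v"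
    and jacobi_identity:
      "u \<in> P p \<Longrightarrow> v \<in> P q \<Longrightarrow> jacobi 1 1 id Y sV (int_modes Y) p q u v x"

definition countable_dimension :: "(complex \<Rightarrow> 'v::ab_group_add \<Rightarrow> 'v) \<Rightarrow> bool"
  where "countable_dimension sV \<longleftrightarrow>
    (\<exists>B. countable B \<and> \<not> module.dependent sV B \<and> module.span sV B = UNIV)"

definition aut_group ::
    "(complex \<Rightarrow> 'v::ab_group_add \<Rightarrow> 'v) \<Rightarrow> ('v \<Rightarrow> int \<Rightarrow> 'v \<Rightarrow> 'v) \<Rightarrow> ('v \<Rightarrow> 'v) monoid"
  where "aut_group sV Y =
    \<lparr>carrier = {g. Vector_Spaces.linear sV sV g \<and> bij g \<and>
                   (\<forall>v n. g \<circ> Y v n \<circ> inv_into UNIV g = Y (g v) n)},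
     monoid.mult = (\<circ>), one = id\<rparr>"

definition center_of :: "('v \<Rightarrow> 'v) set \<Rightarrow> ('v \<Rightarrow> 'v) set"
  where "center_of G = {h \<in> G. \<forall>g\<in>G. h \<circ> g = g \<circ> h}"

definition fixed_points :: "('v \<Rightarrow> 'v) set \<Rightarrow> 'v set"
  where "fixed_points G = {v. \<forall>g\<in>G. g v = v}"


section \<open>Weak twisted modules\<close>

definition primitive_root_of_unity :: "nat \<Rightarrow> complex \<Rightarrow> bool"
  where "primitive_root_of_unity n x \<longleftrightarrow> 0 < n \<and> x ^ n = 1 \<and> (\<forall>k. 0 < k \<and> k < n \<longrightarrow> x ^ k \<noteq> 1)"

locale weak_twisted_module =
  vertex_superalgebra sV P vac D Y + M: vector_space sM
  for sV :: "complex \<Rightarrow> 'v::ab_group_add \<Rightarrow> 'v" and P vac D Y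
    and sM :: "complex \<Rightarrow> 'm::ab_group_add \<Rightarrow> 'm" +
  fixes g :: "'v \<Rightarrow> 'v"
    and T :: nat
    and \<eta> :: complex
    and YM :: "'v \<Rightarrow> rat \<Rightarrow> 'm \<Rightarrow> 'm"
  assumes automorphism: "g \<in> carrier (aut_group sV Y)"
    and order_T: "0 < T" "group.ord (aut_group sV Y) g = T"
    and primitive_root: "primitive_root_of_unity T \<eta>"
    and linear_module_field: "Vector_Spaces.linear sV sM (\<lambda>v. YM v n w)"
    and linear_module_mode: "Vector_Spaces.linear sM sM (YM v n)"
    and mode_exponents: "of_nat T * n \<notin> \<int> \<Longrightarrow> YM v n w = 0"
    and module_truncation: "\<exists>N. \<forall>n\<ge>N. YM v n w = 0"
    and module_vacuum: "YM vac n w = (if n = -1 then w else 0)"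
    and twisted_jacobi_identity:
      "u \<in> P p \<Longrightarrow> v \<in> P q \<Longrightarrow> jacobi T \<eta> g Y sM YM p q u v w"

definition irreducible_on ::
    "(complex \<Rightarrow> 'm \<Rightarrow> 'm) \<Rightarrow> ('v \<Rightarrow> rat \<Rightarrow> 'm \<Rightarrow> 'm) \<Rightarrow> 'v set \<Rightarrow> 'm::ab_group_add set \<Rightarrow> bool"
  where "irreducible_on sM YM U S \<longleftrightarrow>
    (let stable = (\<lambda>N. module.subspace sM N \<and> (\<forall>v\<in>U. \<forall>n. YM v n ` N \<subseteq> N))
     in stable S \<and> S \<noteq> {0} \<and> (\<forall>N. stable N \<and> N \<subseteq> S \<longrightarrow> N = {0} \<or> N = S))"

definition twist_by :: "('v \<Rightarrow> 'v) \<Rightarrow> ('v \<Rightarrow> rat \<Rightarrow> 'm \<Rightarrow> 'm) \<Rightarrow> 'v \<Rightarrow> rat \<Rightarrow> 'm \<Rightarrow> 'm"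
  where "twist_by g YM v n = YM (inv_into UNIV g v) n"

definition module_isomorphic ::
    "(complex \<Rightarrow> 'm::ab_group_add \<Rightarrow> 'm) \<Rightarrow> ('v \<Rightarrow> rat \<Rightarrow> 'm \<Rightarrow> 'm) \<Rightarrow>
     (complex \<Rightarrow> 'n::ab_group_add \<Rightarrow> 'n) \<Rightarrow> ('v \<Rightarrow> rat \<Rightarrow> 'n \<Rightarrow> 'n) \<Rightarrow> bool"
  where "module_isomorphic sM YM sN YN \<longleftrightarrow>
    (\<exists>f. Vector_Spaces.linear sM sN f \<and> bij f \<and> (\<forall>v n w. f (YM v n w) = YN v n (f w)))"


section \<open>The central extension acting on a module\<close>

definition normalized_lift ::
    "('v \<Rightarrow> 'v) set \<Rightarrow> (complex \<Rightarrow> 'm::ab_group_add \<Rightarrow> 'm) \<Rightarrow> ('v \<Rightarrow> rat \<Rightarrow> 'm \<Rightarrow> 'm) \<Rightarrow>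
     (('v \<Rightarrow> 'v) \<Rightarrow> 'm \<Rightarrow> 'm) \<Rightarrow> (('v \<Rightarrow> 'v) \<Rightarrow> ('v \<Rightarrow> 'v) \<Rightarrow> complex) \<Rightarrow> bool"
  where "normalized_lift G sM YM \<phi> \<alpha> \<longleftrightarrow>
    (\<forall>g\<in>G. Vector_Spaces.linear sM sM (\<phi> g) \<and> bij (\<phi> g) \<and>
       (\<forall>v n. inv_into UNIV (\<phi> g) \<circ> YM v n \<circ> \<phi> g = YM (inv_into UNIV g v) n)) \<and>
    (\<forall>g\<in>G. \<forall>k\<in>G. \<phi> g \<circ> \<phi> k = sM (\<alpha> g k) \<circ> \<phi> (g \<circ> k)) \<and>
    (\<forall>g\<in>G. \<forall>k\<in>G. \<exists>m>0. \<alpha> g k ^ m = 1)"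

definition cocycle_exponent :: "'g set \<Rightarrow> ('g \<Rightarrow> 'g \<Rightarrow> complex) \<Rightarrow> nat"
  where "cocycle_exponent G \<alpha> = (LEAST n. 0 < n \<and> (\<forall>g\<in>G. \<forall>k\<in>G. \<alpha> g k ^ n = 1))"

text \<open>
  The section \<open>\<phi>\<close> need not send \<open>id\<close> to the identity, so the neutral element of the extension is
  \<open>(\<alpha>(id,id)^-1, id)\<close>.
\<close>

definition central_extension ::
    "complex \<Rightarrow> ('v \<Rightarrow> 'v) set \<Rightarrow> (('v \<Rightarrow> 'v) \<Rightarrow> ('v \<Rightarrow> 'v) \<Rightarrow> complex) \<Rightarrow> (complex \<times> ('v \<Rightarrow> 'v)) monoid"
  where "central_extension \<xi> G \<alpha> =
    \<lparr>carrier = range (\<lambda>k::nat. \<xi> ^ k) \<times> G,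
     monoid.mult = (\<lambda>(x, g) (y, k). (x * y * \<alpha> g k, g \<circ> k)),
     one = (inverse (\<alpha> id id), id)\<rparr>"

definition extension_action ::
    "(complex \<Rightarrow> 'm \<Rightarrow> 'm) \<Rightarrow> (('v \<Rightarrow> 'v) \<Rightarrow> 'm \<Rightarrow> 'm) \<Rightarrow> complex \<times> ('v \<Rightarrow> 'v) \<Rightarrow> 'm \<Rightarrow> 'm"
  where "extension_action sM \<phi> = (\<lambda>(x, g) w. sM x (\<phi> g w))"

definition irreducible_rep :: "('g, 'b) monoid_scheme \<Rightarrow> nat \<Rightarrow> ('g \<Rightarrow> complex mat) \<Rightarrow> bool"
  where "irreducible_rep K d \<rho> \<longleftrightarrow>
    0 < d \<and> (\<forall>x\<in>carrier K. \<rho> x \<in> carrier_mat d d) \<and> \<rho> \<one>\<^bsub>K\<^esub> = 1\<^sub>m d \<and>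
    (\<forall>x\<in>carrier K. \<forall>y\<in>carrier K. \<rho> (x \<otimes>\<^bsub>K\<^esub> y) = \<rho> x * \<rho> y) \<and>
    (\<forall>W\<subseteq>carrier_vec d.
       0\<^sub>v d \<in> W \<and> (\<forall>a\<in>W. \<forall>b\<in>W. a + b \<in> W) \<and> (\<forall>c. \<forall>a\<in>W. c \<cdot>\<^sub>v a \<in> W) \<and>
       (\<forall>x\<in>carrier K. \<forall>a\<in>W. \<rho> x *\<^sub>v a \<in> W)
       \<longrightarrow> W = {0\<^sub>v d} \<or> W = carrier_vec d)"

definition irreducible_character :: "('g, 'b) monoid_scheme \<Rightarrow> ('g \<Rightarrow> complex) \<Rightarrow> bool"
  where "irreducible_character K \<chi> \<longleftrightarrow>
    (\<exists>d \<rho>. irreducible_rep K d \<rho> \<and> (\<forall>x\<in>carrier K. \<chi> x = (\<Sum>i<d. \<rho> x $$ (i, i))))"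

definition isotypic_projection ::
    "('g, 'b) monoid_scheme \<Rightarrow> (complex \<Rightarrow> 'm \<Rightarrow> 'm) \<Rightarrow> ('g \<Rightarrow> 'm \<Rightarrow> 'm) \<Rightarrow> ('g \<Rightarrow> complex) \<Rightarrow>
     'm \<Rightarrow> 'm::ab_group_add"
  where "isotypic_projection K sM act \<chi> w =
    sM (\<chi> \<one>\<^bsub>K\<^esub> / of_nat (card (carrier K)))
       (\<Sum>x\<in>carrier K. sM (\<chi> (m_inv K x)) (act x w))"

definition isotypic_component ::
    "('g, 'b) monoid_scheme \<Rightarrow> (complex \<Rightarrow> 'm \<Rightarrow> 'm) \<Rightarrow> ('g \<Rightarrow> 'm \<Rightarrow> 'm) \<Rightarrow> ('g \<Rightarrow> complex) \<Rightarrow>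
     'm::ab_group_add set"
  where "isotypic_component K sM act \<chi> = range (isotypic_projection K sM act \<chi>)"

end

theory Submission
  imports Defs
begin

text \<open>
  Two facts make the theorem true. First, in an irreducible twisted module \<open>M\<close> every vector
  \<open>w \<noteq> 0\<close> generates \<open>M\<close> linearly by single modes: \<open>M\<close> is the span of the vectors \<open>v_n w\<close>
  (\<open>single_modes_span\<close>). Secondly, for a linear character \<open>\<lambda>\<close> the projection \<open>P\<^sub>\<lambda>\<close> sends \<open>v_n w\<close>
  with \<open>w \<in> M\<^sup>\<lambda>\<close> to a mode of a \<open>G\<close>-invariant vector. Indeed \<open>x\<close> in the extension, lying over
  \<open>g \<in> G\<close>, satisfies \<open>x (v_n w) = (g v)_n (x w) = \<lambda>(x) (g v)_n w\<close>, so the factor \<open>\<lambda>(x\<inverse>)\<close> in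
  \<open>P\<^sub>\<lambda>\<close> cancels and what remains is a multiple of \<open>u_n w\<close> with \<open>u = \<Sum>g\<in>G. g v\<close>.

  Together these give irreducibility: if \<open>N \<subseteq> M\<^sup>\<lambda>\<close> is stable under \<open>V\<^sup>G\<close> and contains \<open>w \<noteq> 0\<close>, then
  \<open>M\<^sup>\<lambda> = P\<^sub>\<lambda>(M)\<close> is spanned by the vectors \<open>P\<^sub>\<lambda>(v_n w)\<close>, all of which lie in \<open>N\<close>. Stability of
  \<open>M\<^sup>\<lambda>\<close> itself holds because modes of invariant vectors commute with \<open>P\<^sub>\<lambda>\<close>.

  The first fact amounts to: the span \<open>N\<close> of all \<open>v_n w\<close> is stable under every mode. The right-hand
  side of the Jacobi identity applied to \<open>w\<close> consists of modes applied to \<open>w\<close>, so it lies in \<open>N\<close>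
  whatever the coefficients of its delta function are. Extracting the coefficient at
  \<open>z0^(-n-1) z1^(-m-1) z2^(-l-1)\<close> with \<open>m\<close> so large that \<open>u_(m+k) w = 0\<close> for all
  \<open>k \<ge> 0\<close> removes the terms with \<open>u\<close> acting first, and leaves
  \<open>\<Sum>k. (-1)^k (n choose k) u_(m+n-k) v_(l+k) w \<in> N\<close>. Since \<open>v_(l+k) w = 0\<close> for large \<open>k\<close>,
  descending induction on \<open>l\<close> shows that the leading term \<open>u_(m+n) v_l w\<close> is in \<open>N\<close>, and
  \<open>m + n\<close> is arbitrary because \<open>n\<close> may be negative.
\<close>

section \<open>Sums of series and their supports\<close>

context vector_space
begin

lemma subspace_Sum_any:
  assumes "subspace N" "\<And>x. f x \<in> N"
  shows "Sum_any f \<in> N"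
  unfolding Sum_any.expand_set using assms by (intro subspace_sum) auto

text \<open>
  Used to read off the leading term of a Jacobi coefficient. Finiteness of the support is essential:
  otherwise \<open>Sum_any f\<close> is \<open>0\<close> by convention and says nothing about the single values.
\<close>

lemma subspace_Sum_any_isolate:
  assumes N: "subspace N" and fin: "finite {x. f x \<noteq> 0}"
    and total: "Sum_any f \<in> N" and others: "\<And>x. x \<noteq> x0 \<Longrightarrow> f x \<in> N"
  shows "f x0 \<in> N"
proof -
  let ?A = "{x. f x \<noteq> 0}"
  have "Sum_any f = sum f (insert x0 ?A)"
    using fin by (intro Sum_any.expand_superset) auto
  also have "\<dots> = f x0 + sum f (?A - {x0})"
    using fin by (rule sum.insert_remove)
  finally have "f x0 = Sum_any f - sum f (?A - {x0})" by (simp only: add_diff_cancel_right')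
  also have "sum f (?A - {x0}) \<in> N"
    by (rule subspace_sum[OF N]) (simp add: others)
  then have "Sum_any f - sum f (?A - {x0}) \<in> N"
    by (rule subspace_diff[OF N total])
  finally show ?thesis .
qed

end

lemma delta12_support:
  assumes "delta12 e \<noteq> 0"
  obtains n :: int and k :: nat where "e = (- of_int n - 1, of_int n - of_nat k, of_nat k)"
proof -
  obtain nk :: "int \<times> nat" where "(case nk of (n, k) \<Rightarrow> (-1) ^ k * (of_int n gchoose k)
      * monomial3 (- of_int n - 1, of_int n - of_nat k, of_nat k) e) \<noteq> 0"
    using assms unfolding delta12_def by (rule Sum_any.not_neutral_obtains_not_neutral)
  then show ?thesis
    using that by (cases nk) (auto simp: monomial3_def split: if_splits)
qed

lemma delta21_support:
  assumes "delta21 e \<noteq> 0"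
  obtains n :: int and k :: nat where "e = (- of_int n - 1, of_nat k, of_int n - of_nat k)"
proof -
  obtain nk :: "int \<times> nat" where "(case nk of (n, k) \<Rightarrow> (-1) powi n * (-1) ^ k * (of_int n gchoose k)
      * monomial3 (- of_int n - 1, of_nat k, of_int n - of_nat k) e) \<noteq> 0"
    using assms unfolding delta21_def by (rule Sum_any.not_neutral_obtains_not_neutral)
  then show ?thesis
    using that by (cases nk) (auto simp: monomial3_def split: if_splits)
qed

lemma delta12_leading: "delta12 (- of_int n - 1, of_int n, 0) = 1"
proof -
  let ?f = "\<lambda>(m::int, k::nat). (-1) ^ k * (of_int m gchoose k)
      * monomial3 (- of_int m - 1, of_int m - of_nat k, of_nat k) (- of_int n - 1, of_int n, 0)"
  have "?f = (\<lambda>x. if x = (n, 0) then 1 else 0 :: complex)"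
    by (auto simp: fun_eq_iff monomial3_def)
  then show ?thesis
    unfolding delta12_def by simp
qed


section \<open>One vector generates an irreducible twisted module by single modes\<close>

lemmas linear_hom = Vector_Spaces.linear.axioms(3)

context weak_twisted_module
begin

lemma field_add: "YM (u + v) n w = YM u n w + YM v n w"
  using linear_hom[OF linear_module_field, of n w] by (rule module_hom.add)

lemma field_sum: "YM (\<Sum>a\<in>A. f a) n w = (\<Sum>a\<in>A. YM (f a) n w)"
  using linear_hom[OF linear_module_field, of n w] by (rule module_hom.sum)

lemma mode_hom: "module_hom sM sM (YM v n)"
  by (rule linear_hom) (rule linear_module_mode)

lemma mode_zero: "YM v n 0 = 0"
  by (rule module_hom.zero) (rule mode_hom)

lemma mode_add: "YM v n (w + x) = YM v n w + YM v n x"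
  by (rule module_hom.add) (rule mode_hom)

lemma mode_scale: "YM v n (sM c w) = sM c (YM v n w)"
  by (rule module_hom.scale) (rule mode_hom)

lemma mode_sum: "YM v n (\<Sum>a\<in>A. f a) = (\<Sum>a\<in>A. YM v n (f a))"
  by (rule module_hom.sum) (rule mode_hom)

text \<open>
  The series \<open>d\<close> is arbitrary: a coefficient of the product is a combination of modes applied to
  \<open>w\<close>, so the twisted delta function never has to be evaluated.
\<close>

lemma iterate_term_in_subspace:
  assumes "M.subspace N" "\<And>x r. YM x r w \<in> N"
  shows "series_mult sM d (iterate20 Y YM u v w) e \<in> N"
proof -
  have "iterate20 Y YM u v w e' \<in> N" for e'
    using assms(2) M.subspace_0[OF assms(1)] by (cases e') (simp add: iterate20_def)
  then show ?thesis
    unfolding series_mult_def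
    by (intro M.subspace_Sum_any[OF assms(1)] M.subspace_scale[OF assms(1)])
qed

text \<open>
  One coefficient of the Jacobi identity. The terms \<open>v_(l+n-k) u_(m+k) w\<close> vanish by
  \<open>annihilated\<close>, the iterate terms lie in \<open>N\<close> by \<open>modes\<close>, and the remaining products other than
  the leading one lie in \<open>N\<close> by \<open>lower\<close>.
\<close>

lemma leading_product_in_subspace:
  assumes u: "u \<in> P p" and v: "v \<in> P q"
    and N: "M.subspace N" and modes: "\<And>x r. YM x r w \<in> N"
    and annihilated: "\<And>k::nat. YM u (m + of_nat k) w = 0"
    and lower: "\<And>k::nat. 0 < k \<Longrightarrow> YM u (m + of_int n - of_nat k) (YM v (l + of_nat k) w) \<in> N"
  shows "YM u (m + of_int n) (YM v l w) \<in> N"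
proof -
  let ?e = "(- of_int n - 1, - m - 1, - l - 1) :: rat \<times> rat \<times> rat"
  let ?f = "\<lambda>e'. sM (delta12 e') (prod12 YM u v w (?e - e'))"
  \<comment> \<open>A factor \<open>Y(u,z1) Y(v,z2) w\<close> has no \<open>z0\<close>, so only the exponents \<open>?x k\<close> of the first delta
    function contribute, one for each \<open>k\<close>.\<close>
  let ?x = "\<lambda>k::nat. (- of_int n - 1, of_int n - of_nat k, of_nat k) :: rat \<times> rat \<times> rat"
  have term_eq: "?f (?x k) = sM (delta12 (?x k)) (YM u (m + of_int n - of_nat k) (YM v (l + of_nat k) w))" for k
    by (simp add: prod12_def algebra_simps)
  have off: "?f e' = 0" if "e' \<notin> range ?x" for e'
  proof (cases "delta12 e' = 0")
    case False
    then obtain n' k where "e' = (- of_int n' - 1, of_int n' - of_nat k, of_nat k)"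
      by (rule delta12_support)
    moreover have "n' \<noteq> n"
    proof
      assume "n' = n"
      with calculation have "e' = ?x k" by (simp only:)
      with that show False by blast
    qed
    ultimately show ?thesis by (simp add: prod12_def)
  qed simp
  obtain N0 where N0: "\<And>r. r \<ge> N0 \<Longrightarrow> YM v r w = 0"
    using module_truncation by blast
  obtain K :: nat where "N0 - l \<le> of_nat K" using real_arch_simple by blast
  have K: "N0 \<le> l + of_nat k" if "K \<le> k" for k
  proof -
    have "(of_nat K :: rat) \<le> of_nat k" using that by (simp only: of_nat_le_iff)
    then show ?thesis using \<open>N0 - l \<le> of_nat K\<close> by linarith
  qed
  have "{e'. ?f e' \<noteq> 0} \<subseteq> ?x ` {..<K}"
  proof
    fix e' assume "e' \<in> {e'. ?f e' \<noteq> 0}"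
    then have ne: "?f e' \<noteq> 0" by simp
    with off obtain k where k: "e' = ?x k" by blast
    have "k < K"
    proof (rule ccontr)
      assume "\<not> k < K"
      then have "YM v (l + of_nat k) w = 0" by (intro N0 K) simp
      then have "?f e' = 0" by (simp only: k term_eq mode_zero M.scale_zero_right)
      with ne show False by simp
    qed
    then show "e' \<in> ?x ` {..<K}" using k by blast
  qed
  then have fin: "finite {e'. ?f e' \<noteq> 0}" by (rule finite_subset) simp
  have "series_mult sM delta21 (prod21 YM u v w) ?e = 0"
  proof -
    have "sM (delta21 e') (prod21 YM u v w (?e - e')) = 0" for e'
    proof (cases "delta21 e' = 0")
      case False
      then obtain n' k where "e' = (- of_int n' - 1, of_nat k, of_int n' - of_nat k)"
        by (rule delta21_support)
      moreover have "YM u (- (- m - 1 - of_nat k) - 1) w = 0"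
        using annihilated[of k] by (simp add: add.commute)
      ultimately show ?thesis
        by (simp only: prod21_def diff_Pair prod.case mode_zero if_cancel M.scale_zero_right)
    qed simp
    then show ?thesis unfolding series_mult_def by (simp only: Sum_any.neutral)
  qed
  moreover have "Sum_any ?f
        - sM (if p = 1 \<and> q = 1 then -1 else 1) (series_mult sM delta21 (prod21 YM u v w) ?e)
      = sM (1 / of_nat T)
          (\<Sum>j<T. series_mult sM (delta10 T \<eta> j) (iterate20 Y YM ((g ^^ j) u) v w) ?e)"
    using twisted_jacobi_identity[OF u v, of w]
    unfolding jacobi_def series_mult_def[of sM delta12] by (rule spec)
  ultimately have "Sum_any ?f = sM (1 / of_nat T)
      (\<Sum>j<T. series_mult sM (delta10 T \<eta> j) (iterate20 Y YM ((g ^^ j) u) v w) ?e)"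
    by (simp only: M.scale_zero_right diff_zero)
  also have "\<dots> \<in> N"
    by (intro M.subspace_scale[OF N] M.subspace_sum[OF N] iterate_term_in_subspace[OF N modes])
  finally have "Sum_any ?f \<in> N" .
  then have "?f (?x 0) \<in> N"
  proof (rule M.subspace_Sum_any_isolate[OF N fin])
    fix e' assume ne: "e' \<noteq> ?x 0"
    show "?f e' \<in> N"
    proof (cases "e' \<in> range ?x")
      case True
      then obtain k where k: "e' = ?x k" by blast
      with ne have "0 < k" by (cases k) auto
      then show ?thesis
        unfolding k term_eq by (rule M.subspace_scale[OF N lower])
    qed (simp add: off M.subspace_0[OF N])
  qed
  then show ?thesis
    unfolding term_eq by (simp add: delta12_leading)
qed

lemma product_of_homogeneous_modes_in_subspace:
  assumes u: "u \<in> P p" and v: "v \<in> P q"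
    and N: "M.subspace N" and modes: "\<And>x r. YM x r w \<in> N"
  shows "YM u i (YM v l w) \<in> N"
proof -
  obtain A where A: "\<And>r. r \<ge> A \<Longrightarrow> YM u r w = 0" using module_truncation by blast
  obtain B where B: "\<And>r. r \<ge> B \<Longrightarrow> YM v r w = 0" using module_truncation by blast
  \<comment> \<open>The number \<open>d\<close> bounds the distance from \<open>l\<close> to the region where \<open>v_l w = 0\<close>; the index \<open>i\<close> is
    general because the induction hypothesis is needed at \<open>i - k\<close>.\<close>
  have "YM u i (YM v l w) \<in> N" if "B \<le> l + of_nat d" for d i l
    using that
  proof (induction d arbitrary: i l rule: less_induct)
    case (less d)
    show ?case
    proof (cases "d = 0")
      case True
      then show ?thesis
        using less.prems B M.subspace_0[OF N]
        by (simp add: mode_zero)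
    next
      case False
      \<comment> \<open>Write \<open>i = m + n\<close> with \<open>m = i + s\<close> in the region where \<open>u\<close> annihilates \<open>w\<close> and \<open>n = -s\<close>.\<close>
      obtain s :: nat where s: "of_nat s \<ge> A - i" using real_arch_simple by blast
      have "YM u (i + of_nat s + of_int (- int s)) (YM v l w) \<in> N"
      proof (rule leading_product_in_subspace[OF u v N modes])
        fix k :: nat
        show "YM u (i + of_nat s + of_nat k) w = 0"
        proof (rule A)
          have "(0::rat) \<le> of_nat k" by simp
          then show "A \<le> i + of_nat s + of_nat k" using s by linarith
        qed
      next
        fix k :: nat assume k: "0 < k"
        show "YM u (i + of_nat s + of_int (- int s) - of_nat k) (YM v (l + of_nat k) w) \<in> N"
        proof (rule less.IH)
          show "d - k < d" using k False by simp
          have "d \<le> k + (d - k)" by simp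
          then have "(of_nat d :: rat) \<le> of_nat k + of_nat (d - k)"
            by (simp only: of_nat_le_iff flip: of_nat_add)
          then show "B \<le> l + of_nat k + of_nat (d - k)" using less.prems by linarith
        qed
      qed
      then show ?thesis by simp
    qed
  qed
  moreover obtain d :: nat where "B - l \<le> of_nat d" using real_arch_simple by blast
  then have "B \<le> l + of_nat d" by linarith
  ultimately show ?thesis by blast
qed

text \<open>
  The Jacobi identity is only available for vectors of definite parity. The subspace \<open>N\<close> contains the
  modes of all vectors applied to \<open>w\<close>, so the even and odd parts can be treated one at a time.
\<close>

lemma product_of_modes_in_subspace:
  assumes N: "M.subspace N" and modes: "\<And>x r. YM x r w \<in> N"
  shows "YM u i (YM v l w) \<in> N"
proof -
  have decompose: "\<exists>a b. a \<in> P 0 \<and> b \<in> P 1 \<and> x = a + b" for x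
    using parity_direct_sum[of x] by auto
  obtain a b where u: "a \<in> P 0" "b \<in> P 1" "u = a + b" using decompose by blast
  obtain c d where v: "c \<in> P 0" "d \<in> P 1" "v = c + d" using decompose by blast
  have "YM u i (YM v l w) = (YM a i (YM c l w) + YM a i (YM d l w))
      + (YM b i (YM c l w) + YM b i (YM d l w))"
    by (simp only: u(3) v(3) field_add mode_add add_ac)
  also have "\<dots> \<in> N"
    using u(1,2) v(1,2) by (intro M.subspace_add[OF N])
      (rule product_of_homogeneous_modes_in_subspace[OF _ _ N modes], assumption+)+
  finally show ?thesis .
qed

text \<open>
  The span of the \<open>v_n w\<close> is a submodule since products of two modes reduce to single ones, and it
  contains \<open>w = \<one>_(-1) w\<close>.
\<close>

lemma single_modes_span:
  assumes irr: "irreducible_on sM YM UNIV UNIV" and w: "w \<noteq> 0"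
  shows "M.span (range (\<lambda>(v, n). YM v n w)) = UNIV"
proof -
  let ?N = "M.span (range (\<lambda>(v, n). YM v n w))"
  have base: "YM v n w \<in> ?N" for v n
    by (rule M.span_base) (rule range_eqI[of _ _ "(v, n)"], simp)
  have stable: "YM u i ` ?N \<subseteq> ?N" for u i
  proof -
    have "?N \<subseteq> {x. YM u i x \<in> ?N}"
    proof (rule M.span_minimal)
      show "range (\<lambda>(v, n). YM v n w) \<subseteq> {x. YM u i x \<in> ?N}"
        using product_of_modes_in_subspace[OF M.subspace_span base] by (simp add: image_subset_iff)
      show "M.subspace {x. YM u i x \<in> ?N}"
        by (rule module_hom.subspace_linear_preimage[OF mode_hom M.subspace_span])
    qed
    then show ?thesis by blast
  qed
  have "\<And>N. M.subspace N \<Longrightarrow> (\<And>v n. YM v n ` N \<subseteq> N) \<Longrightarrow> N = {0} \<or> N = UNIV"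
    using irr unfolding irreducible_on_def Let_def by simp
  from this[OF M.subspace_span stable] have "?N = {0} \<or> ?N = UNIV" .
  moreover have "w \<in> ?N" using base[of vac "-1"] by (simp add: module_vacuum)
  ultimately show ?thesis using w by auto
qed

end


section \<open>The central extension and its linear characters\<close>

text \<open>
  The group-theoretic part depends only on the operators \<open>\<phi> g\<close> and their cocycle. Closure under
  inverses is a consequence for a finite set of injective maps closed under composition.
\<close>

locale projective_representation = M: vector_space sM
  for sM :: "complex \<Rightarrow> 'm::ab_group_add \<Rightarrow> 'm" +
  fixes G :: "('v \<Rightarrow> 'v) set"
    and \<phi> :: "('v \<Rightarrow> 'v) \<Rightarrow> 'm \<Rightarrow> 'm"
    and \<alpha> :: "('v \<Rightarrow> 'v) \<Rightarrow> ('v \<Rightarrow> 'v) \<Rightarrow> complex"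
    and \<xi> :: complex
  assumes finite_G: "finite G" and id_G: "id \<in> G"
    and comp_G: "a \<in> G \<Longrightarrow> b \<in> G \<Longrightarrow> a \<circ> b \<in> G"
    and inj_G: "a \<in> G \<Longrightarrow> inj a"
    and linear_\<phi>: "a \<in> G \<Longrightarrow> Vector_Spaces.linear sM sM (\<phi> a)"
    and bij_\<phi>: "a \<in> G \<Longrightarrow> bij (\<phi> a)"
    and \<phi>_comp: "a \<in> G \<Longrightarrow> b \<in> G \<Longrightarrow> \<phi> a (\<phi> b w) = sM (\<alpha> a b) (\<phi> (a \<circ> b) w)"
    and \<alpha>_finite_order: "a \<in> G \<Longrightarrow> b \<in> G \<Longrightarrow> \<exists>m>0. \<alpha> a b ^ m = 1"
    and root_\<xi>: "primitive_root_of_unity (cocycle_exponent G \<alpha>) \<xi>"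
    and nontrivial: "\<exists>w::'m. w \<noteq> 0"
begin

abbreviation "K \<equiv> central_extension \<xi> G \<alpha>"
abbreviation "act \<equiv> extension_action sM \<phi>"

lemma \<phi>_scale: "a \<in> G \<Longrightarrow> \<phi> a (sM c w) = sM c (\<phi> a w)"
  by (rule module_hom.scale) (rule linear_hom, rule linear_\<phi>)

lemma bij_betw_left_translation:
  assumes "a \<in> G"
  shows "bij_betw ((\<circ>) a) G G"
proof -
  have "inj_on ((\<circ>) a) G"
    using fun.inj_map[OF inj_G[OF assms]] by (rule inj_on_subset) simp
  moreover have "(\<circ>) a ` G \<subseteq> G" using comp_G assms by auto
  ultimately show ?thesis
    using finite_G by (simp add: bij_betw_def endo_inj_surj)
qed

lemma \<alpha>_nonzero: "a \<in> G \<Longrightarrow> b \<in> G \<Longrightarrow> \<alpha> a b \<noteq> 0"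
  using \<alpha>_finite_order[of a b] by (auto simp: power_0_left)

text \<open>
  Compare the two ways of reducing \<open>\<phi> a \<circ> \<phi> b \<circ> \<phi> c\<close> on a vector where the result is nonzero.
\<close>

lemma cocycle:
  assumes "a \<in> G" "b \<in> G" "c \<in> G"
  shows "\<alpha> a b * \<alpha> (a \<circ> b) c = \<alpha> b c * \<alpha> a (b \<circ> c)"
proof -
  obtain w :: 'm where w: "w \<noteq> 0" using nontrivial by blast
  have abc: "a \<circ> b \<circ> c \<in> G" using assms comp_G by blast
  obtain y where y: "\<phi> (a \<circ> b \<circ> c) y = w" using bij_\<phi>[OF abc] by (metis bij_pointE)
  have "sM (\<alpha> a b * \<alpha> (a \<circ> b) c) w = \<phi> a (\<phi> b (\<phi> c y))"
    by (simp only: \<phi>_comp[OF assms(1,2)] \<phi>_comp[OF comp_G[OF assms(1,2)] assms(3)] y M.scale_scale)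
  also have "\<dots> = sM (\<alpha> b c * \<alpha> a (b \<circ> c)) w"
  proof -
    have "\<phi> a (\<phi> b (\<phi> c y)) = \<phi> a (sM (\<alpha> b c) (\<phi> (b \<circ> c) y))"
      by (simp only: \<phi>_comp assms)
    also have "\<dots> = sM (\<alpha> b c) (\<phi> a (\<phi> (b \<circ> c) y))"
      by (rule \<phi>_scale[OF assms(1)])
    also have "\<phi> a (\<phi> (b \<circ> c) y) = sM (\<alpha> a (b \<circ> c)) (\<phi> (a \<circ> (b \<circ> c)) y)"
      by (rule \<phi>_comp[OF assms(1) comp_G[OF assms(2,3)]])
    also have "\<phi> (a \<circ> (b \<circ> c)) y = w"
      using y by (simp only: comp_assoc)
    finally show ?thesis by (simp only: M.scale_scale)
  qed
  finally show ?thesis using w by simp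
qed

lemma \<alpha>_id_left: "a \<in> G \<Longrightarrow> \<alpha> id a = \<alpha> id id"
  using cocycle[of id id a] \<alpha>_nonzero[of id a] id_G by simp

text \<open>
  The product of the finitely many orders is a common exponent, so the least one exists.
\<close>

lemma power_exponent:
  assumes "a \<in> G" "b \<in> G"
  shows "\<alpha> a b ^ cocycle_exponent G \<alpha> = 1"
proof -
  define m where "m x = (SOME k. 0 < k \<and> \<alpha> (fst x) (snd x) ^ k = 1)" for x
  have m: "0 < m (c, d) \<and> \<alpha> c d ^ m (c, d) = 1" if "c \<in> G" "d \<in> G" for c d
    using someI_ex[OF \<alpha>_finite_order[OF that]] by (simp add: m_def)
  define n where "n = (\<Prod>x\<in>G \<times> G. m x)"
  have "0 < n"
    unfolding n_def by (rule prod_pos) (use m in force)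
  moreover have "\<alpha> c d ^ n = 1" if cd: "c \<in> G" "d \<in> G" for c d
  proof -
    have "m (c, d) dvd n"
      unfolding n_def using finite_G cd by (intro dvd_prodI) auto
    then obtain k where "n = m (c, d) * k" by (rule dvdE)
    then show ?thesis using m[OF cd] by (simp add: power_mult)
  qed
  ultimately have "0 < n \<and> (\<forall>c\<in>G. \<forall>d\<in>G. \<alpha> c d ^ n = 1)" by blast
  from LeastI[of "\<lambda>n. 0 < n \<and> (\<forall>c\<in>G. \<forall>d\<in>G. \<alpha> c d ^ n = 1)", OF this]
  show ?thesis
    using assms unfolding cocycle_exponent_def by blast
qed

text \<open>
  A primitive \<open>n\<close>-th root has \<open>n\<close> distinct powers, which must be all \<open>n\<close>-th roots of unity. In this
  form the values of the cocycle are visibly in the kernel of the extension, which is what makes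
  the twisted product closed.
\<close>

lemma powers_\<xi>_eq: "range (\<lambda>k::nat. \<xi> ^ k) = {x. x ^ cocycle_exponent G \<alpha> = 1}"
proof -
  let ?n = "cocycle_exponent G \<alpha>"
  have n: "0 < ?n" "\<xi> ^ ?n = 1" "\<And>k. 0 < k \<Longrightarrow> k < ?n \<Longrightarrow> \<xi> ^ k \<noteq> 1"
    using root_\<xi> by (auto simp: primitive_root_of_unity_def)
  have nz: "\<xi> \<noteq> 0" using n(1,2) by (auto simp: power_0_left)
  have sub: "range (\<lambda>k::nat. \<xi> ^ k) \<subseteq> {x. x ^ ?n = 1}"
  proof (rule image_subsetI)
    fix k
    have "(\<xi> ^ k) ^ ?n = (\<xi> ^ ?n) ^ k" by (simp add: mult.commute flip: power_mult)
    then show "\<xi> ^ k \<in> {x. x ^ ?n = 1}" by (simp add: n(2))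
  qed
  have inj: "inj_on (\<lambda>k::nat. \<xi> ^ k) {..<?n}"
  proof (rule linorder_inj_onI')
    fix i j assume ij: "i \<in> {..<?n}" "j \<in> {..<?n}" "i < j"
    then have "\<xi> ^ j = \<xi> ^ i * \<xi> ^ (j - i)" by (simp flip: power_add)
    moreover have "\<xi> ^ (j - i) \<noteq> 1" using n(3)[of "j - i"] ij by auto
    ultimately show "\<xi> ^ i \<noteq> \<xi> ^ j" using nz by auto
  qed
  have "(\<lambda>k::nat. \<xi> ^ k) ` {..<?n} = {x. x ^ ?n = 1}"
  proof (rule card_subset_eq)
    show "finite {x::complex. x ^ ?n = 1}"
      using n(1) by (intro finite_roots_unity) simp
    show "(\<lambda>k::nat. \<xi> ^ k) ` {..<?n} \<subseteq> {x. x ^ ?n = 1}" using sub by blast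
    show "card ((\<lambda>k::nat. \<xi> ^ k) ` {..<?n}) = card {x::complex. x ^ ?n = 1}"
      using n(1) by (simp add: card_image[OF inj] card_roots_unity_eq)
  qed
  then show ?thesis using sub by blast
qed

lemma carrier_K: "carrier K = {x. x ^ cocycle_exponent G \<alpha> = 1} \<times> G"
  by (simp add: central_extension_def powers_\<xi>_eq)

lemma mult_K: "(x, a) \<otimes>\<^bsub>K\<^esub> (y, b) = (x * y * \<alpha> a b, a \<circ> b)"
  by (simp add: central_extension_def)

lemma exponent_pos: "0 < cocycle_exponent G \<alpha>"
  using root_\<xi> by (simp add: primitive_root_of_unity_def)

lemma finite_K: "finite (carrier K)"
  unfolding carrier_K using finite_G exponent_pos by (intro finite_cartesian_product finite_roots_unity) auto

lemma group_K: "group K"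
proof (rule groupI)
  fix x y assume "x \<in> carrier K" "y \<in> carrier K"
  then show "x \<otimes>\<^bsub>K\<^esub> y \<in> carrier K"
    by (auto simp: carrier_K mult_K comp_G power_mult_distrib power_exponent)
next
  show "\<one>\<^bsub>K\<^esub> \<in> carrier K"
    unfolding carrier_K using id_G power_exponent[of id id]
    by (simp add: central_extension_def power_inverse)
next
  fix x y z assume "x \<in> carrier K" "y \<in> carrier K" "z \<in> carrier K"
  then obtain r a t b q c
    where xyz: "x = (r, a)" "y = (t, b)" "z = (q, c)" and G: "a \<in> G" "b \<in> G" "c \<in> G"
    by (auto simp: carrier_K)
  have "x \<otimes>\<^bsub>K\<^esub> y \<otimes>\<^bsub>K\<^esub> z = ((r * t * q) * (\<alpha> a b * \<alpha> (a \<circ> b) c), a \<circ> (b \<circ> c))"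
    by (simp add: xyz mult_K comp_assoc)
  also have "\<dots> = x \<otimes>\<^bsub>K\<^esub> (y \<otimes>\<^bsub>K\<^esub> z)"
    unfolding cocycle[OF G] by (simp add: xyz mult_K)
  finally show "x \<otimes>\<^bsub>K\<^esub> y \<otimes>\<^bsub>K\<^esub> z = x \<otimes>\<^bsub>K\<^esub> (y \<otimes>\<^bsub>K\<^esub> z)" .
next
  fix x assume "x \<in> carrier K"
  then obtain t a where x: "x = (t, a)" and a: "a \<in> G" by (auto simp: carrier_K)
  have "inverse (\<alpha> id id) * t * \<alpha> id a = t"
    using \<alpha>_nonzero[OF id_G id_G] by (simp add: \<alpha>_id_left[OF a])
  then show "\<one>\<^bsub>K\<^esub> \<otimes>\<^bsub>K\<^esub> x = x"
    by (simp add: x central_extension_def)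
next
  fix x assume "x \<in> carrier K"
  then obtain t a where x: "x = (t, a)" "t ^ cocycle_exponent G \<alpha> = 1" "a \<in> G"
    by (auto simp: carrier_K)
  obtain b where b: "b \<in> G" "b \<circ> a = id"
  proof -
    have "id \<in> (\<circ>) a ` G"
      unfolding bij_betw_imp_surj_on[OF bij_betw_left_translation[OF x(3)]] by (rule id_G)
    then obtain b where b: "b \<in> G" "id = a \<circ> b" by (rule imageE)
    have "a \<circ> (b \<circ> a) = a \<circ> id" by (simp only: b(2)[symmetric] comp_assoc[symmetric] id_comp comp_id)
    then have "b \<circ> a = id"
      using inj_onD[OF bij_betw_imp_inj_on[OF bij_betw_left_translation[OF x(3)]]]
        comp_G[OF b(1) x(3)] id_G by blast
    with b(1) show ?thesis by (rule that)
  qed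
  have t: "t \<noteq> 0" using x(2) exponent_pos by (auto simp: power_0_left)
  let ?y = "(inverse (t * \<alpha> b a * \<alpha> id id), b)"
  have "?y \<in> carrier K"
    using x b id_G by (simp add: carrier_K power_inverse power_mult_distrib power_exponent)
  moreover have "?y \<otimes>\<^bsub>K\<^esub> x = \<one>\<^bsub>K\<^esub>"
    unfolding x(1) mult_K using t b \<alpha>_nonzero[OF b(1) x(3)]
    by (simp add: central_extension_def field_simps)
  ultimately show "\<exists>y\<in>carrier K. y \<otimes>\<^bsub>K\<^esub> x = \<one>\<^bsub>K\<^esub>" by blast
qed

lemma linear_act: "x \<in> carrier K \<Longrightarrow> module_hom sM sM (act x)"
proof -
  assume "x \<in> carrier K"
  then obtain t a where x: "x = (t, a)" and a: "a \<in> G" by (auto simp: carrier_K)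
  have "\<phi> a (v + w) = \<phi> a v + \<phi> a w" for v w
    by (rule module_hom.add) (rule linear_hom, rule linear_\<phi>[OF a])
  then show "module_hom sM sM (act x)"
    by (simp add: module_hom_iff M.module_axioms x extension_action_def
        \<phi>_scale[OF a] M.scale_right_distrib mult.commute)
qed

lemma act_mult:
  assumes "x \<in> carrier K" "y \<in> carrier K"
  shows "act (x \<otimes>\<^bsub>K\<^esub> y) w = act x (act y w)"
  using assms
  by (auto simp: carrier_K mult_K extension_action_def \<phi>_comp
      \<phi>_scale)

lemma isotypic_projection_linear: "module_hom sM sM (isotypic_projection K sM act \<chi>)"
proof -
  have "isotypic_projection K sM act \<chi> (v + w)
      = isotypic_projection K sM act \<chi> v + isotypic_projection K sM act \<chi> w" for v w
    by (simp add: isotypic_projection_def module_hom.add[OF linear_act] sum.distrib M.scale_right_distrib)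
  moreover have "isotypic_projection K sM act \<chi> (sM c v) = sM c (isotypic_projection K sM act \<chi> v)" for c v
    by (simp add: isotypic_projection_def module_hom.scale[OF linear_act] M.scale_sum_right mult_ac)
  ultimately show ?thesis
    by (simp add: module_hom_iff M.module_axioms)
qed

text \<open>
  Translating the summation variable of the projection by \<open>x\<close> produces the factor \<open>\<chi> x\<close>. This is where
  the character must be linear: for higher degree \<open>\<chi>\<close> is not multiplicative, and an isotypic
  component is not an eigenspace.
\<close>

lemma act_isotypic:
  assumes mult: "\<And>x y. x \<in> carrier K \<Longrightarrow> y \<in> carrier K \<Longrightarrow> \<chi> (x \<otimes>\<^bsub>K\<^esub> y) = \<chi> x * \<chi> y"
    and x: "x \<in> carrier K" and w: "w \<in> isotypic_component K sM act \<chi>"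
  shows "act x w = sM (\<chi> x) w"
proof -
  interpret K: group K by (rule group_K)
  obtain y where y: "w = isotypic_projection K sM act \<chi> y"
    using w by (auto simp: isotypic_component_def)
  let ?c = "\<chi> \<one>\<^bsub>K\<^esub> / of_nat (card (carrier K))"
  have bij: "bij_betw (\<lambda>z. x \<otimes>\<^bsub>K\<^esub> z) (carrier K) (carrier K)"
    using K.inj_on_cmult[OF x] K.surj_const_mult[OF x] by (simp add: bij_betw_def)
  have "act x w = sM ?c (\<Sum>z\<in>carrier K. sM (\<chi> (inv\<^bsub>K\<^esub> z)) (act (x \<otimes>\<^bsub>K\<^esub> z) y))"
    unfolding y isotypic_projection_def
    using x by (simp add: module_hom.scale[OF linear_act] module_hom.sum[OF linear_act] act_mult)
  also have "(\<Sum>z\<in>carrier K. sM (\<chi> (inv\<^bsub>K\<^esub> z)) (act (x \<otimes>\<^bsub>K\<^esub> z) y))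
      = (\<Sum>z\<in>carrier K. sM (\<chi> x * \<chi> (inv\<^bsub>K\<^esub> (x \<otimes>\<^bsub>K\<^esub> z))) (act (x \<otimes>\<^bsub>K\<^esub> z) y))"
  proof (rule sum.cong)
    fix z assume z: "z \<in> carrier K"
    have "inv\<^bsub>K\<^esub> z = inv\<^bsub>K\<^esub> (x \<otimes>\<^bsub>K\<^esub> z) \<otimes>\<^bsub>K\<^esub> x"
      using x z by (simp add: K.inv_mult_group K.m_assoc)
    also have "\<chi> \<dots> = \<chi> (inv\<^bsub>K\<^esub> (x \<otimes>\<^bsub>K\<^esub> z)) * \<chi> x"
      using x z by (intro mult K.inv_closed K.m_closed)
    finally have "\<chi> (inv\<^bsub>K\<^esub> z) = \<chi> x * \<chi> (inv\<^bsub>K\<^esub> (x \<otimes>\<^bsub>K\<^esub> z))"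
      by (simp only: mult.commute)
    then show "sM (\<chi> (inv\<^bsub>K\<^esub> z)) (act (x \<otimes>\<^bsub>K\<^esub> z) y)
        = sM (\<chi> x * \<chi> (inv\<^bsub>K\<^esub> (x \<otimes>\<^bsub>K\<^esub> z))) (act (x \<otimes>\<^bsub>K\<^esub> z) y)" by simp
  qed simp
  also have "\<dots> = (\<Sum>z\<in>carrier K. sM (\<chi> x * \<chi> (inv\<^bsub>K\<^esub> z)) (act z y))"
    using bij by (rule sum.reindex_bij_betw)
  also have "sM ?c \<dots> = sM (\<chi> x) w"
    by (simp add: y isotypic_projection_def M.scale_sum_right mult_ac)
  finally show ?thesis .
qed

end

text \<open>
  The value of a character at the identity is its degree, so the representation is by 1-by-1
  matrices and equals its trace.
\<close>

lemma linear_character_mult: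
  assumes "irreducible_character K \<chi>" "\<chi> \<one>\<^bsub>K\<^esub> = 1" "group K"
    and x: "x \<in> carrier K" and y: "y \<in> carrier K"
  shows "\<chi> (x \<otimes>\<^bsub>K\<^esub> y) = \<chi> x * \<chi> y"
proof -
  interpret K: group K by fact
  obtain d \<rho> where \<rho>: "irreducible_rep K d \<rho>"
    and \<chi>: "\<And>x. x \<in> carrier K \<Longrightarrow> \<chi> x = (\<Sum>i<d. \<rho> x $$ (i, i))"
    using assms(1) by (auto simp: irreducible_character_def)
  have carrier_\<rho>: "\<And>z. z \<in> carrier K \<Longrightarrow> \<rho> z \<in> carrier_mat d d" and one_\<rho>: "\<rho> \<one>\<^bsub>K\<^esub> = 1\<^sub>m d"
    and mult_\<rho>: "\<rho> (x \<otimes>\<^bsub>K\<^esub> y) = \<rho> x * \<rho> y"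
    using \<rho> x y unfolding irreducible_rep_def by blast+
  have "\<chi> \<one>\<^bsub>K\<^esub> = of_nat d"
    by (simp add: \<chi> one_\<rho>)
  then have d: "d = 1" using assms(2) by simp
  note mult_\<rho>
  moreover have "(\<rho> x * \<rho> y) $$ (0, 0) = \<rho> x $$ (0, 0) * \<rho> y $$ (0, 0)"
    using carrier_\<rho>[OF x] carrier_\<rho>[OF y] by (simp add: d scalar_prod_def)
  ultimately show ?thesis
    using x y by (simp add: \<chi> d)
qed


section \<open>Irreducibility of the isotypic component\<close>

theorem theorem4p9:
  fixes sV :: "complex \<Rightarrow> 'v::ab_group_add \<Rightarrow> 'v"
    and P :: "bit \<Rightarrow> 'v set" and vac :: 'v and D :: "'v \<Rightarrow> 'v"
    and Y :: "'v \<Rightarrow> int \<Rightarrow> 'v \<Rightarrow> 'v"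
    and G :: "('v \<Rightarrow> 'v) set" and h :: "'v \<Rightarrow> 'v"
    and sM :: "complex \<Rightarrow> 'm::ab_group_add \<Rightarrow> 'm"
    and T :: nat and \<eta> :: complex
    and YM :: "'v \<Rightarrow> rat \<Rightarrow> 'm \<Rightarrow> 'm"
    and \<phi> :: "('v \<Rightarrow> 'v) \<Rightarrow> 'm \<Rightarrow> 'm"
    and \<alpha> :: "('v \<Rightarrow> 'v) \<Rightarrow> ('v \<Rightarrow> 'v) \<Rightarrow> complex"
    and \<xi> :: complex
    and chi :: "complex \<times> ('v \<Rightarrow> 'v) \<Rightarrow> complex"
  defines "Ghat \<equiv> central_extension \<xi> G \<alpha>"
  defines "M_lam \<equiv> isotypic_component Ghat sM (extension_action sM \<phi>) chi"
  assumes "vertex_superalgebra sV P vac D Y"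
    and "countable_dimension sV"
    and "subgroup G (aut_group sV Y)" and "finite G"
    and "h \<in> center_of G"
    and "weak_twisted_module sV P vac D Y sM h T \<eta> YM"
    and "irreducible_on sM YM UNIV UNIV"
    and "\<forall>g\<in>G. module_isomorphic sM YM sM (twist_by g YM)"
    and "normalized_lift G sM YM \<phi> \<alpha>"
    and "primitive_root_of_unity (cocycle_exponent G \<alpha>) \<xi>"
    and "irreducible_character Ghat chi" and "chi \<one>\<^bsub>Ghat\<^esub> = 1"
    and "M_lam \<noteq> {0}"
  shows "irreducible_on sM YM (fixed_points G) M_lam"
proof -
  interpret W: weak_twisted_module sV P vac D Y sM h T \<eta> YM by fact
  have lift: "Vector_Spaces.linear sM sM (\<phi> a)" "bij (\<phi> a)"
      "\<And>v n. inv_into UNIV (\<phi> a) \<circ> YM v n \<circ> \<phi> a = YM (inv_into UNIV a v) n" if "a \<in> G" for a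
    using \<open>normalized_lift G sM YM \<phi> \<alpha>\<close> that unfolding normalized_lift_def by auto
  have aut: "Vector_Spaces.linear sV sV a" "bij a" if "a \<in> G" for a
    using subgroup.subset[OF \<open>subgroup G (aut_group sV Y)\<close>] that by (auto simp: aut_group_def)
  interpret R: projective_representation sM G \<phi> \<alpha> \<xi>
  proof (intro projective_representation.intro projective_representation_axioms.intro)
    show "vector_space sM" by (rule W.M.vector_space_axioms)
    show "finite G" by fact
    show "id \<in> G"
      using subgroup.one_closed[OF \<open>subgroup G (aut_group sV Y)\<close>] by (simp add: aut_group_def)
    show "a \<circ> b \<in> G" if "a \<in> G" "b \<in> G" for a b
      using subgroup.m_closed[OF \<open>subgroup G (aut_group sV Y)\<close> that] by (simp add: aut_group_def)
    show "inj a" if "a \<in> G" for a using aut(2)[OF that] by (rule bij_is_inj)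
    show "Vector_Spaces.linear sM sM (\<phi> a)" if "a \<in> G" for a using lift(1)[OF that] .
    show "bij (\<phi> a)" if "a \<in> G" for a using lift(2)[OF that] .
    show "\<phi> a (\<phi> b w) = sM (\<alpha> a b) (\<phi> (a \<circ> b) w)" if "a \<in> G" "b \<in> G" for a b w
    proof -
      have "\<phi> a \<circ> \<phi> b = sM (\<alpha> a b) \<circ> \<phi> (a \<circ> b)"
        using \<open>normalized_lift G sM YM \<phi> \<alpha>\<close> that by (simp add: normalized_lift_def)
      from fun_cong[OF this, of w] show ?thesis by simp
    qed
    show "\<exists>m>0. \<alpha> a b ^ m = 1" if "a \<in> G" "b \<in> G" for a b
      using \<open>normalized_lift G sM YM \<phi> \<alpha>\<close> that by (simp add: normalized_lift_def)
    show "primitive_root_of_unity (cocycle_exponent G \<alpha>) \<xi>" by fact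
    show "\<exists>w::'m. w \<noteq> 0"
      using \<open>irreducible_on sM YM UNIV UNIV\<close> unfolding irreducible_on_def Let_def by blast
  qed
  define p where "p = isotypic_projection Ghat sM (extension_action sM \<phi>) chi"
  have M_lam: "M_lam = range p"
    by (simp add: M_lam_def p_def isotypic_component_def)
  have p_hom: "module_hom sM sM p"
    unfolding p_def Ghat_def by (rule R.isotypic_projection_linear)
  have chi_mult: "chi (x \<otimes>\<^bsub>Ghat\<^esub> y) = chi x * chi y" if "x \<in> carrier Ghat" "y \<in> carrier Ghat" for x y
    using \<open>irreducible_character Ghat chi\<close> \<open>chi \<one>\<^bsub>Ghat\<^esub> = 1\<close> R.group_K that
    unfolding Ghat_def by (intro linear_character_mult)
  have act_M_lam: "extension_action sM \<phi> x w = sM (chi x) w"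
    if "x \<in> carrier Ghat" "w \<in> M_lam" for x w
    using that chi_mult unfolding Ghat_def M_lam_def by (intro R.act_isotypic)
  \<comment> \<open>The lift intertwines the module structure with the action of \<open>G\<close> on \<open>V\<close>.\<close>
  have act_mode: "extension_action sM \<phi> x (YM v n w) = YM (snd x v) n (extension_action sM \<phi> x w)"
    if xK: "x \<in> carrier Ghat" for x v n w
  proof -
    obtain t a where x: "x = (t, a)" "a \<in> G"
      using xK by (auto simp: Ghat_def R.carrier_K)
    have "inv_into UNIV (\<phi> a) (YM (a v) n (\<phi> a w)) = YM v n w"
      using fun_cong[OF lift(3)[OF x(2), of "a v" n], of w] bij_is_inj[OF aut(2)[OF x(2)]] by simp
    then have "\<phi> a (YM v n w) = YM (a v) n (\<phi> a w)"
      using bij_is_surj[OF lift(2)[OF x(2)]] by (metis UNIV_I f_inv_into_f)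
    then show ?thesis
      by (simp add: x(1) extension_action_def
          W.mode_scale)
  qed
  have p_eq: "p w = sM (1 / of_nat (card (carrier Ghat)))
      (\<Sum>x\<in>carrier Ghat. sM (chi (inv\<^bsub>Ghat\<^esub> x)) (extension_action sM \<phi> x w))" for w
    by (simp add: p_def isotypic_projection_def \<open>chi \<one>\<^bsub>Ghat\<^esub> = 1\<close>)
  have p_fixed: "p (YM v n w) = YM v n (p w)" if v: "v \<in> fixed_points G" for v n w
  proof -
    have "snd x v = v" if "x \<in> carrier Ghat" for x
      using v that by (auto simp: fixed_points_def Ghat_def R.carrier_K)
    then show ?thesis
      unfolding p_eq
      by (simp add: act_mode W.mode_scale
          W.mode_sum)
  qed
  \<comment> \<open>On a mode applied to \<open>M_lam\<close> the projection averages the vector of \<open>V\<close> over \<open>G\<close>. The constant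
    is \<open>1/|G|\<close>, as the kernel order divided by the order of the extension; only membership of
    multiples of \<open>u_n w\<close> in a subspace matters below.\<close>
  have p_mode: "\<exists>c. \<exists>u\<in>fixed_points G. p (YM v n w) = sM c (YM u n w)" if w: "w \<in> M_lam" for v n w
  proof -
    define u where "u = (\<Sum>a\<in>G. a v)"
    have u: "u \<in> fixed_points G"
    proof -
      have "b u = u" if b: "b \<in> G" for b
      proof -
        have "b u = (\<Sum>a\<in>G. (b \<circ> a) v)"
          unfolding u_def by (simp add: module_hom.sum[OF linear_hom[OF aut(1)[OF b]]])
        also have "\<dots> = u"
          unfolding u_def by (rule sum.reindex_bij_betw[OF R.bij_betw_left_translation[OF b]])
        finally show ?thesis .
      qed
      then show ?thesis by (simp add: fixed_points_def)
    qed
    interpret K: group Ghat unfolding Ghat_def by (rule R.group_K)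
    let ?E = "{x::complex. x ^ cocycle_exponent G \<alpha> = 1}"
    have "sM (chi (inv\<^bsub>Ghat\<^esub> x)) (extension_action sM \<phi> x (YM v n w)) = YM (snd x v) n w"
      if x: "x \<in> carrier Ghat" for x
    proof -
      have "chi (inv\<^bsub>Ghat\<^esub> x) * chi x = 1"
        using chi_mult[of "inv\<^bsub>Ghat\<^esub> x" x] x \<open>chi \<one>\<^bsub>Ghat\<^esub> = 1\<close> by simp
      then show ?thesis
        using x w by (simp add: act_mode act_M_lam
            W.mode_scale)
    qed
    then have "p (YM v n w) = sM (1 / of_nat (card (carrier Ghat)))
        (\<Sum>x\<in>carrier Ghat. YM (snd x v) n w)"
      unfolding p_eq by simp
    also have "(\<Sum>x\<in>carrier Ghat. YM (snd x v) n w) = (\<Sum>t\<in>?E. \<Sum>a\<in>G. YM (a v) n w)"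
      by (simp add: Ghat_def R.carrier_K sum.cartesian_product case_prod_unfold)
    also have "\<dots> = sM (of_nat (card ?E)) (YM u n w)"
      by (simp add: u_def W.field_sum W.M.sum_constant_scale)
    finally have "p (YM v n w)
        = sM (1 / of_nat (card (carrier Ghat)) * of_nat (card ?E)) (YM u n w)"
      by (simp only: W.M.scale_scale)
    with u show ?thesis by blast
  qed
  show ?thesis
    unfolding irreducible_on_def Let_def
  proof (intro conjI allI impI ballI)
    show "W.M.subspace M_lam"
      unfolding M_lam by (rule module_hom.subspace_image[OF p_hom W.M.subspace_UNIV])
    show "YM v n ` M_lam \<subseteq> M_lam" if "v \<in> fixed_points G" for v n
      unfolding M_lam by (auto simp flip: p_fixed[OF that])
    show "M_lam \<noteq> {0}" by fact
  next
    fix N assume N: "(W.M.subspace N \<and> (\<forall>v\<in>fixed_points G. \<forall>n. YM v n ` N \<subseteq> N)) \<and> N \<subseteq> M_lam"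
    have "M_lam \<subseteq> N" if ne: "N \<noteq> {0}"
    proof -
      obtain w where w: "w \<in> N" "w \<noteq> 0"
        using ne N W.M.subspace_0[of N] by blast
      have "W.M.span (range (\<lambda>(v, n). YM v n w)) \<subseteq> {x. p x \<in> N}"
      proof (rule W.M.span_minimal)
        show "W.M.subspace {x. p x \<in> N}"
          using N by (intro module_hom.subspace_linear_preimage[OF p_hom]) simp
        have "p (YM v n w) \<in> N" for v n
        proof -
          obtain c u where "u \<in> fixed_points G" "p (YM v n w) = sM c (YM u n w)"
            using p_mode[of w v n] w N by blast
          then show ?thesis using N w by (auto intro!: W.M.subspace_scale)
        qed
        then show "range (\<lambda>(v, n). YM v n w) \<subseteq> {x. p x \<in> N}" by (simp add: image_subset_iff)
      qed
      then have "p x \<in> N" for x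
        using W.single_modes_span[OF \<open>irreducible_on sM YM UNIV UNIV\<close> w(2)] by blast
      then show ?thesis unfolding M_lam by blast
    qed
    then show "N = {0} \<or> N = M_lam" using N by blast
  qed
qed

end
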